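(* Let $\Lambda=\{1,\dots,N\}$, and for each $i\in\Lambda$ let $X_i\subseteq\mathbb R^{n_i}$; put $n=\sum_{i\in\Lambda} n_i$ and $X=\prod_{i\in\Lambda}X_i\subseteq\mathbb R^n$. Let $P_i:X\rightrightarrows X_i$ and $K_i:X\rightrightarrows X_i$ be multi-valued maps and $K(x)=\prod_{i\in\Lambda}K_i(x)$. Suppose that for each $i\in\Lambda$: (a) $X_i$ is a non-empty, closed and convex subset of $\mathbb R^{n_i}$; (b) $K_i$ is a closed and lower semi-continuous map, with $K_i(x)$ non-empty and convex for every $x\in X$; (c) $P_i$ is a lower semi-continuous map with open upper sections, and $x_i\notin co(P_i(x))$ for every $x\in X$. Suppose moreover that the coercivity criterion $(\mathcal C_x)$ holds at every $x\in X$ with constant $\rho_x>0$, that is: for every $y\in K(x)\setminus\bar B(0,\rho_x)$ there exists $z\in K(x)$ with $\|z\|<\|y\|$ and $z_i\in P_i(y)$ for all $i\in\Lambda$; and that there exists a real number $\rho>\sup\{\rho_x\mid x\in X\}$ such that $K(x)\cap\bar B(0,\rho)\ne\emptyset$ for each $x\in X$. Then there exists an equilibrium for the game $\Gamma=(X_i,K_i,P_i)_{i\in\Lambda}$.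
   Context: Notation: $x=(x_i)_{i\in\Lambda}$; $co$ denotes convex hull; $\|\cdot\|$ is the Euclidean norm and $\bar B(0,r)$ the closed ball of radius $r$ centred at $0$ in $\mathbb R^n$. Values of $P_i$ may be empty. A multi-valued map is closed if its graph is closed (in the product of its domain and its codomain). Open upper sections: $P_i$ has open upper sections if $P_i(x)$ is open (as a subset of $\mathbb R^{n_i}$) for every $x\in X$. Equilibrium: $\tilde x\in X$ is an equilibrium for $\Gamma$ if, for each $i\in\Lambda$, $\tilde x_i\in K_i(\tilde x)$ and $P_i(\tilde x)\cap K_i(\tilde x)=\emptyset$. *)

theory Defs
  imports "HOL-Analysis.Analysis"
begin

text \<open>
  Strategy profiles are vectors \<open>x :: (real^'m)^'i\<close>: the finite type \<open>'i\<close> is the set of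
  players, and \<open>x $ i\<close> is the strategy of player \<open>i\<close>.  Since the dimensions \<open>n\<^sub>i\<close> may differ,
  the strategy space of player \<open>i\<close> is realised as the coordinate subspace of \<open>real^'m\<close>
  belonging to a coordinate set \<open>J i :: 'm set\<close> with \<open>n\<^sub>i = card (J i)\<close>; every finite
  family of dimensions arises this way, with \<open>CARD('m)\<close> at least the largest \<open>n\<^sub>i\<close>.
  The library norm on \<open>(real^'m)^'i\<close> is the \<open>\<ell>\<^sup>2\<close>-norm of the \<open>\<ell>\<^sup>2\<close>-norms of the
  components, so on the product of these subspaces it is the Euclidean norm of dimension
  \<open>\<Sum>i. card (J i)\<close>.
\<close>

definition coord_space :: "'m set \<Rightarrow> (real^'m::finite) set" where
  "coord_space J = {v. \<forall>j. j \<notin> J \<longrightarrow> v $ j = 0}"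

definition prod_set :: "('i::finite \<Rightarrow> 'a set) \<Rightarrow> ('a^'i) set" where
  "prod_set S = {x. \<forall>i. x $ i \<in> S i}"

text \<open>
  A multi-valued map from \<open>S\<close> to \<open>T\<close> is a function \<open>F \<in> S \<rightarrow> Pow T\<close>; its values outside \<open>S\<close>
  are irrelevant.
\<close>

definition closed_multimap ::
    "'a::topological_space set \<Rightarrow> 'b::topological_space set \<Rightarrow> ('a \<Rightarrow> 'b set) \<Rightarrow> bool" where
  "closed_multimap S T F \<longleftrightarrow>
     closedin (top_of_set (S \<times> T)) {(x, y). x \<in> S \<and> y \<in> F x}"

definition lsc_multimap ::
    "'a::topological_space set \<Rightarrow> 'b::topological_space set \<Rightarrow> ('a \<Rightarrow> 'b set) \<Rightarrow> bool" where
  "lsc_multimap S T F \<longleftrightarrow>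
     (\<forall>U. openin (top_of_set T) U \<longrightarrow> openin (top_of_set S) {x \<in> S. F x \<inter> U \<noteq> {}})"

definition coercive_at ::
    "('i::finite \<Rightarrow> (real^'m::finite)^'i \<Rightarrow> (real^'m) set) \<Rightarrow>
     ('i \<Rightarrow> (real^'m)^'i \<Rightarrow> (real^'m) set) \<Rightarrow> (real^'m)^'i \<Rightarrow> real \<Rightarrow> bool" where
  "coercive_at K P x r \<longleftrightarrow>
     (\<forall>y \<in> prod_set (\<lambda>i. K i x) - cball 0 r.
        \<exists>z \<in> prod_set (\<lambda>i. K i x). norm z < norm y \<and> (\<forall>i. z $ i \<in> P i y))"

definition equilibrium ::
    "('i::finite \<Rightarrow> (real^'m::finite) set) \<Rightarrow>
     ('i \<Rightarrow> (real^'m)^'i \<Rightarrow> (real^'m) set) \<Rightarrow>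
     ('i \<Rightarrow> (real^'m)^'i \<Rightarrow> (real^'m) set) \<Rightarrow> (real^'m)^'i \<Rightarrow> bool" where
  "equilibrium X K P x \<longleftrightarrow>
     x \<in> prod_set X \<and> (\<forall>i. x $ i \<in> K i x \<and> P i x \<inter> K i x = {})"

end

theory Submission
  imports Defs
begin

text \<open>
  At every profile \<open>x\<close> choose unit vectors \<open>s $ i\<close> with \<open>s $ i \<bullet> (z - x $ i) \<ge> 0\<close> on
  \<open>P i x\<close>; openness of \<open>P i x\<close> makes the inequality strict, so it survives taking convex
  combinations.  A Kakutani argument on \<open>X\<close> intersected with the ball of radius \<open>rho\<close>, times
  a product of unit balls, yields \<open>x \<in> K x\<close> and a convex combination \<open>t\<close> of such
  vectors such that \<open>x\<close> maximises \<open>t\<close> over the truncated set \<open>K x\<close>.  If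
  \<open>norm x = rho\<close>, coercivity gives a shorter \<open>z \<in> K x\<close> preferred by all players, hence
  \<open>t \<bullet> z > t \<bullet> x\<close>, a contradiction.  So \<open>x\<close> is interior to the ball, maximality
  extends by convexity to all of \<open>K x\<close>, and a point of \<open>P i x \<inter> K i x\<close> would again
  improve on \<open>t \<bullet> x\<close>.
\<close>

section \<open>Fixed points of correspondences, up to convex hulls\<close>

text \<open>The map \<open>g\<close> may be discontinuous, so Brouwer is applied to a continuous
  blend of its values: a partition of unity over a finite \<open>e\<close>-net averages the values
  of \<open>g\<close> at the net points. At a fixed point of the blend, only net points closer than
  \<open>e\<close> carry weight.\<close>

lemma approximate_fixed_point:
  fixes S :: "'a::euclidean_space set"
  assumes S: "compact S" "convex S" "S \<noteq> {}"
    and g: "\<And>x. x \<in> S \<Longrightarrow> g x \<in> S"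
    and e: "e > 0"
  shows "\<exists>x\<in>S. x \<in> convex hull (g ` {c \<in> S. dist x c < e})"
proof -
  obtain k where k: "finite k" "k \<subseteq> S" "S \<subseteq> (\<Union>c\<in>k. ball c e)"
    using seq_compact_imp_totally_bounded[of S] S(1) e by (metis compact_imp_seq_compact)
  \<comment> \<open>Tent functions vanishing outside the \<open>e\<close>-balls around the net
    points. Their sum \<open>\<Phi>\<close> is positive on \<open>S\<close> because these balls
    cover \<open>S\<close>, so dividing by it yields convex weights.\<close>
  define \<phi> where "\<phi> = (\<lambda>c (x::'a). max 0 (e - dist x c))"
  define \<Phi> where "\<Phi> = (\<lambda>x. \<Sum>c\<in>k. \<phi> c x)"
  define f where "f = (\<lambda>x. \<Sum>c\<in>k. (\<phi> c x / \<Phi> x) *\<^sub>R g c)"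
  have \<phi>_nonneg: "\<phi> c x \<ge> 0" for c x
    by (simp add: \<phi>_def)
  have \<Phi>_pos: "\<Phi> x > 0" if x: "x \<in> S" for x
  proof -
    obtain c where c: "c \<in> k" "dist x c < e"
      using k(3) x by (auto simp: dist_commute)
    then show ?thesis
      unfolding \<Phi>_def by (intro sum_pos2[OF k(1) c(1)]) (auto simp: \<phi>_def)
  qed
  have weights: "(\<Sum>c\<in>k. \<phi> c x / \<Phi> x) = 1" if "x \<in> S" for x
    using \<Phi>_pos[OF that] unfolding \<Phi>_def by (simp flip: sum_divide_distrib)
  have "f x \<in> S" if x: "x \<in> S" for x
    unfolding f_def using k g x \<Phi>_pos[OF x] \<phi>_nonneg
    by (intro convex_sum[OF k(1) S(2) weights[OF x]]) (auto intro: divide_nonneg_pos)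
  moreover have "continuous_on S f"
    unfolding f_def \<Phi>_def \<phi>_def using \<Phi>_pos
    by (intro continuous_intros) (force simp: \<Phi>_def \<phi>_def)
  ultimately obtain x where x: "x \<in> S" "f x = x"
    using brouwer[OF S] by blast
  define k' where "k' = {c \<in> k. dist x c < e}"
  have k': "finite k'" "k' \<subseteq> k" and zero: "\<And>c. c \<in> k - k' \<Longrightarrow> \<phi> c x = 0"
    using k(1) by (auto simp: k'_def \<phi>_def)
  have "(\<Sum>c\<in>k'. \<phi> c x / \<Phi> x) = 1"
    using weights[OF x(1)] sum.mono_neutral_left[OF k(1) k'(2), of "\<lambda>c. \<phi> c x / \<Phi> x"] zero
    by simp
  then have "(\<Sum>c\<in>k'. (\<phi> c x / \<Phi> x) *\<^sub>R g c) \<in> convex hull (g ` {c \<in> S. dist x c < e})"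
    using k(2) \<Phi>_pos[OF x(1)] \<phi>_nonneg
    by (intro convex_sum[OF k'(1) convex_convex_hull])
      (auto simp: k'_def intro!: hull_inc divide_nonneg_pos)
  moreover have "f x = (\<Sum>c\<in>k'. (\<phi> c x / \<Phi> x) *\<^sub>R g c)"
    unfolding f_def using zero by (intro sum.mono_neutral_right[OF k(1) k'(2)]) simp
  ultimately show ?thesis
    using x by auto
qed

text \<open>Kakutani's theorem, with the convexity of the values traded for a convex hull in
  the conclusion.\<close>

lemma kakutani_convex_hull:
  fixes S :: "'a::euclidean_space set"
  assumes S: "compact S" "convex S" "S \<noteq> {}"
    and G: "closed G" "G \<subseteq> S \<times> S"
    and ex: "\<And>x. x \<in> S \<Longrightarrow> \<exists>y. (x, y) \<in> G"
  shows "\<exists>x\<in>S. x \<in> convex hull {y. (x, y) \<in> G}"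
proof -
  obtain g where g: "\<And>x. x \<in> S \<Longrightarrow> (x, g x) \<in> G"
    using ex by metis
  have "\<exists>x\<in>S. x \<in> convex hull (g ` {c \<in> S. dist x c < inverse (Suc n)})" for n
    using g G(2) by (intro approximate_fixed_point S) auto
  then obtain X where X: "\<And>n. X n \<in> S"
      "\<And>n. X n \<in> convex hull (g ` {c \<in> S. dist (X n) c < inverse (Suc n)})"
    by metis
  obtain x \<sigma> where x: "x \<in> S" "strict_mono \<sigma>" and lim: "(X \<circ> \<sigma>) \<longlonglongrightarrow> x"
    using S(1) X(1) unfolding compact_def by metis
  define C where "C = convex hull {y. (x, y) \<in> G}"
  have "compact G"
    using G S(1) by (metis compact_Int_closed compact_Times inf.absorb_iff2)
  moreover have "{y. (x, y) \<in> G} = snd ` (G \<inter> ({x} \<times> UNIV))"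
    by force
  ultimately have "compact {y. (x, y) \<in> G}"
    by (auto intro!: compact_continuous_image compact_Int_closed continuous_intros closed_Times)
  then have C: "compact C"
    unfolding C_def by (rule compact_convex_hull)
  \<comment> \<open>The values at \<open>x\<close> form a compact set and the dimension is finite,
    so their hull \<open>C\<close> is compact. Hence it suffices to find points of \<open>C\<close>
    arbitrarily near \<open>x\<close>.\<close>
  have "x \<in> closure C"
    unfolding closure_approachable
  proof (intro allI impI)
    fix e :: real
    assume e: "e > 0"
    \<comment> \<open>As the Minkowski sum of the convex set \<open>C\<close> and a ball, the open
      neighbourhood \<open>U\<close> of \<open>C\<close> is again convex. It can therefore absorb
      convex hulls of nearby values.\<close>
    define U where "U = (\<Union>c\<in>C. ball c (e / 2))"
    have "U = (\<Union>c\<in>C. \<Union>b\<in>ball 0 (e / 2). {c + b})"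
      by (auto simp: U_def ball_def dist_norm norm_minus_commute intro: bexI[of _ "_ - _"])
         (metis add_diff_cancel_left' add.commute diff_add_cancel norm_minus_commute)
    then have "convex U"
      using convex_sums[of C "ball 0 (e / 2)"] by (simp add: C_def)
    \<comment> \<open>Upper semicontinuity by projection: the points with some value outside
      \<open>U\<close> form a compact set. It misses \<open>x\<close>, so it misses a whole ball
      around \<open>x\<close>.\<close>
    have "compact (fst ` (G \<inter> (UNIV \<times> - U)))"
      using \<open>compact G\<close>
      by (auto intro!: compact_continuous_image compact_Int_closed continuous_intros
          closed_Times simp: U_def closed_Compl)
    moreover have "x \<notin> fst ` (G \<inter> (UNIV \<times> - U))"
      using e by (force simp: U_def C_def intro: hull_inc)
    ultimately obtain d where d: "d > 0" "ball x d \<subseteq> - fst ` (G \<inter> (UNIV \<times> - U))"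
      by (metis ComplI compact_imp_closed open_Compl open_contains_ball)
    have "eventually (\<lambda>n. dist ((X \<circ> \<sigma>) n) x < min (d / 2) (e / 2)) sequentially"
      using d e by (intro tendstoD[OF lim]) simp
    moreover have "eventually (\<lambda>n. inverse (real (Suc n)) < d / 2) sequentially"
      using d by (intro order_tendstoD(2)[OF LIMSEQ_inverse_real_of_nat]) simp
    ultimately obtain n where n: "dist (X (\<sigma> n)) x < d / 2" "dist (X (\<sigma> n)) x < e / 2"
        "inverse (real (Suc n)) < d / 2"
      using eventually_happens[OF eventually_conj] by force
    \<comment> \<open>The radius belongs to the index \<open>\<sigma> n\<close>, which is at least
      \<open>n\<close>. Each \<open>c\<close> used in the hull is then within
      \<open>d / 2 + d / 2\<close> of \<open>x\<close>.\<close>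
    have "inverse (real (Suc (\<sigma> n))) \<le> inverse (real (Suc n))"
      using seq_suble[OF x(2), of n] by (simp add: field_simps)
    with n have close: "inverse (real (Suc (\<sigma> n))) < d / 2"
      by linarith
    have "g c \<in> U" if c: "c \<in> S" "dist (X (\<sigma> n)) c < inverse (Suc (\<sigma> n))" for c
    proof -
      have "dist x c < d"
        using dist_triangle3[of x c "X (\<sigma> n)"] c(2) n(1) close by linarith
      then have "c \<notin> fst ` (G \<inter> (UNIV \<times> - U))"
        using d(2) by auto
      then show ?thesis
        using g[OF c(1)] by force
    qed
    then have "X (\<sigma> n) \<in> U"
      using X(2)[of "\<sigma> n"]
        hull_minimal[of "g ` {c \<in> S. dist (X (\<sigma> n)) c < inverse (Suc (\<sigma> n))}" U convex]
        \<open>convex U\<close> by (auto simp: image_subset_iff)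
    then obtain c where "c \<in> C" "dist c (X (\<sigma> n)) < e / 2"
      by (auto simp: U_def)
    then show "\<exists>y\<in>C. dist y x < e"
      using n(2) dist_triangle[of c x "X (\<sigma> n)"] by (intro bexI[of _ c]) auto
  qed
  then show ?thesis
    using x(1) C by (auto simp: C_def compact_imp_closed)
qed

section \<open>Consequences of lower semicontinuity\<close>

text \<open>Failure is an open condition: a violating \<open>w\<close> lies in the open complement
  of \<open>C\<close>, and lower semicontinuity supplies values near \<open>w\<close> at all nearby
  base points, which violate it too. The map \<open>h\<close> extracts the base point from a larger
  tuple, so that \<open>C\<close> may also involve the other components.\<close>

lemma closed_all_lsc_multimap:
  fixes h :: "'c::topological_space \<Rightarrow> 'a::topological_space"
    and C :: "('c \<times> 'b::topological_space) set"
  assumes F: "lsc_multimap S T F" "F \<in> S \<rightarrow> Pow T"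
    and h: "continuous_on UNIV h" and S: "closed S" and C: "closed C"
  shows "closed {v. h v \<in> S \<and> (\<forall>w\<in>F (h v). (v, w) \<in> C)}" (is "closed ?Z")
proof -
  have "openin (top_of_set (h -` S)) (h -` S - ?Z)"
  proof (subst openin_subopen, intro ballI)
    fix v
    assume "v \<in> h -` S - ?Z"
    then obtain w where v: "h v \<in> S" and w: "w \<in> F (h v)" "(v, w) \<in> - C"
      by auto
    obtain A B where AB: "open A" "open B" "(v, w) \<in> A \<times> B" "A \<times> B \<subseteq> - C"
      using open_prod_elim[OF open_Compl[OF C] w(2)] by blast
    have "openin (top_of_set S) {x \<in> S. F x \<inter> (T \<inter> B) \<noteq> {}}"
      using F(1) AB(2) unfolding lsc_multimap_def by blast
    then obtain V where V: "open V" "{x \<in> S. F x \<inter> (T \<inter> B) \<noteq> {}} = S \<inter> V"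
      unfolding openin_open by blast
    have "open (h -` V \<inter> A)"
      using h V(1) AB(1) by (metis open_Int open_vimage)
    moreover have "v \<in> h -` S \<inter> (h -` V \<inter> A)"
      using V(2) v w AB(3) F(2) by fastforce
    moreover have "h -` S \<inter> (h -` V \<inter> A) \<subseteq> h -` S - ?Z"
    proof
      fix u
      assume u: "u \<in> h -` S \<inter> (h -` V \<inter> A)"
      then have "h u \<in> {x \<in> S. F x \<inter> (T \<inter> B) \<noteq> {}}"
        using V(2) by auto
      then obtain b where "b \<in> F (h u)" "b \<in> B"
        by auto
      then show "u \<in> h -` S - ?Z"
        using u AB(4) by auto
    qed
    ultimately show "\<exists>W. openin (top_of_set (h -` S)) W \<and> v \<in> W \<and> W \<subseteq> h -` S - ?Z"
      by (meson openin_open_Int)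
  qed
  then have "closedin (top_of_set (h -` S)) ?Z"
    unfolding closedin_def by auto
  then show ?thesis
    using closedin_closed_trans closed_vimage[OF S h] by blast
qed

text \<open>Every neighbourhood of \<open>w\<close> contains an open box. Hitting the box can be
  tested coordinate by coordinate, and finitely many relatively open conditions intersect in a
  relatively open one.\<close>

lemma lsc_multimap_prod_set:
  fixes F :: "'i::finite \<Rightarrow> 'a::topological_space \<Rightarrow> 'b::topological_space set"
  assumes "\<And>i. lsc_multimap S (T i) (F i)" and F: "\<And>i. F i \<in> S \<rightarrow> Pow (T i)"
  shows "lsc_multimap S (prod_set T) (\<lambda>x. prod_set (\<lambda>i. F i x))"
  unfolding lsc_multimap_def
proof (intro allI impI)
  fix U
  assume "openin (top_of_set (prod_set T)) U"
  then obtain V where V: "open V" "U = prod_set T \<inter> V"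
    unfolding openin_open by blast
  show "openin (top_of_set S) {x \<in> S. prod_set (\<lambda>i. F i x) \<inter> U \<noteq> {}}" (is "openin _ ?W")
  proof (subst openin_subopen, intro ballI)
    fix x
    assume "x \<in> ?W"
    then obtain w where x: "x \<in> S" and w: "\<And>i. w $ i \<in> F i x" "w \<in> V"
      using V(2) by (auto simp: prod_set_def)
    obtain B where B: "\<And>i. open (B i)" "\<And>i. w $ i \<in> B i"
        "\<And>y. (\<forall>i. y $ i \<in> B i) \<Longrightarrow> y \<in> V"
      using V(1) w(2) unfolding open_vec_def by metis
    define D where "D = (\<lambda>i. {y \<in> S. F i y \<inter> (T i \<inter> B i) \<noteq> {}})"
    have "openin (top_of_set S) (D i)" for i
      using assms(1)[of i] openin_open_Int[OF B(1)] unfolding lsc_multimap_def D_def by blast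
    then have "openin (top_of_set S) (\<Inter>i. D i)"
      by (intro openin_INT2) auto
    moreover have "x \<in> (\<Inter>i. D i)"
      using x w(1) B(2) F unfolding D_def by fastforce
    moreover have "(\<Inter>i. D i) \<subseteq> ?W"
    proof
      fix y
      assume y: "y \<in> (\<Inter>i. D i)"
      then have "\<exists>b. b \<in> F i y \<inter> (T i \<inter> B i)" for i
        unfolding D_def by blast
      then obtain b where "\<And>i. b i \<in> F i y \<inter> (T i \<inter> B i)"
        by metis
      then have "vec_lambda b \<in> prod_set (\<lambda>i. F i y) \<inter> U"
        using B(3)[of "vec_lambda b"] V(2) by (auto simp: prod_set_def)
      then show "y \<in> ?W"
        using y unfolding D_def by blast
    qed
    ultimately show "\<exists>W'. openin (top_of_set S) W' \<and> x \<in> W' \<and> W' \<subseteq> ?W"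
      by blast
  qed
qed

section \<open>Topology and convexity of finite products\<close>

lemma prod_set_eq_INT: "prod_set S = (\<Inter>i. (\<lambda>x. x $ i) -` S i)"
  by (auto simp: prod_set_def)

lemma closed_prod_set: "(\<And>i. closed (S i)) \<Longrightarrow> closed (prod_set S)"
  unfolding prod_set_eq_INT by (intro closed_INT ballI closed_vimage continuous_intros)

lemma convex_prod_set:
  fixes S :: "'i::finite \<Rightarrow> 'a::real_vector set"
  shows "(\<And>i. convex (S i)) \<Longrightarrow> convex (prod_set S)"
  unfolding convex_def prod_set_def by simp

lemma compact_prod_set:
  fixes S :: "'i::finite \<Rightarrow> 'a::euclidean_space set"
  assumes S: "\<And>i. compact (S i)"
  shows "compact (prod_set S)"
proof -
  obtain b where b: "\<And>i x. x \<in> S i \<Longrightarrow> norm x \<le> b i"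
    using S[THEN compact_imp_bounded] unfolding bounded_iff by metis
  have "norm x \<le> (\<Sum>i\<in>UNIV. b i)" if "x \<in> prod_set S" for x
  proof -
    have "norm x \<le> (\<Sum>i\<in>UNIV. norm (x $ i))"
      unfolding norm_vec_def by (intro L2_set_le_sum) simp
    also have "\<dots> \<le> (\<Sum>i\<in>UNIV. b i)"
      using that b by (intro sum_mono) (simp add: prod_set_def)
    finally show ?thesis .
  qed
  then have "bounded (prod_set S)"
    unfolding bounded_iff by blast
  then show ?thesis
    using closed_prod_set[of S] S by (simp add: compact_eq_bounded_closed)
qed

section \<open>Separation inside coordinate subspaces\<close>

lemma subspace_coord_space: "subspace (coord_space J)"
  by (simp add: subspace_def coord_space_def)

text \<open>The origin is separated from the hull translated by \<open>-a\<close>. Taking the normal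
  in the span of that translate keeps it in the coordinate subspace, which matters because preferred
  sets are open only relative to that subspace.\<close>

lemma separating_unit_vector:
  assumes P: "P \<subseteq> coord_space J" "P \<noteq> {}"
    and a: "a \<in> coord_space J" "a \<notin> convex hull P"
  shows "\<exists>s. s \<in> coord_space J \<and> norm s = 1 \<and> (\<forall>z\<in>P. 0 \<le> s \<bullet> (z - a))"
proof -
  define Q where "Q = (\<lambda>z. z - a) ` (convex hull P)"
  have sub: "Q \<subseteq> coord_space J"
    using hull_minimal[OF P(1), of convex] subspace_coord_space[of J] a(1)
    by (auto simp: Q_def subspace_imp_convex intro: subspace_diff)
  have Q: "convex Q" "Q \<noteq> {}" "0 \<notin> Q"
    using a P(2) by (auto simp: Q_def convex_translation_subtract)
  from separating_hyperplane_set_0_inspan[OF this]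
  obtain s where s: "s \<in> span Q" "s \<noteq> 0" "\<And>q. q \<in> Q \<Longrightarrow> 0 \<le> s \<bullet> q"
    by auto
  have "s \<in> coord_space J"
    using span_minimal[OF sub subspace_coord_space] s(1) by blast
  then show ?thesis
    using s(2,3) subspace_scale[OF subspace_coord_space]
    by (intro exI[of _ "s /\<^sub>R norm s"]) (auto simp: Q_def hull_inc)
qed

text \<open>A small step from \<open>z\<close> along \<open>-s\<close> stays in \<open>P\<close>,
  since \<open>s\<close> lies in the subspace where \<open>P\<close> is open. The weak inequality at
  the shifted point leaves a slack of \<open>e * (s \<bullet> s)\<close> at
  \<open>z\<close>.\<close>

lemma supporting_vector_strict:
  assumes P: "openin (top_of_set (coord_space J)) P" and z: "z \<in> P"
    and s: "s \<in> coord_space J" "s \<noteq> 0" "\<And>z. z \<in> P \<Longrightarrow> 0 \<le> s \<bullet> (z - a)"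
  shows "0 < s \<bullet> (z - a)"
proof -
  obtain V where V: "open V" "P = coord_space J \<inter> V"
    using P unfolding openin_open by blast
  have "((\<lambda>e. z - e *\<^sub>R s) \<longlongrightarrow> z - 0 *\<^sub>R s) (at_right 0)"
    by (intro tendsto_intros)
  then have "eventually (\<lambda>e. z - e *\<^sub>R s \<in> V) (at_right 0)"
    using V z by (intro topological_tendstoD) auto
  then obtain e :: real where e: "e > 0" "z - e *\<^sub>R s \<in> V"
    using eventually_happens[OF eventually_conj[OF _ eventually_at_right_less[of 0]]] by force
  have "z - e *\<^sub>R s \<in> P"
    using e(2) V z s(1) subspace_coord_space[of J]
    by (auto intro: subspace_diff subspace_scale)
  from s(3)[OF this] have "e * (s \<bullet> s) \<le> s \<bullet> (z - a)"
    by (simp add: inner_diff_right)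
  moreover have "0 < e * (s \<bullet> s)"
    using e(1) s(2) by simp
  ultimately show ?thesis
    by linarith
qed

section \<open>The problem truncated to a ball\<close>

type_synonym ('m, 'i) graph_point =
  "(((real, 'm) vec, 'i) vec \<times> ((real, 'm) vec, 'i) vec) \<times>
   (((real, 'm) vec, 'i) vec \<times> ((real, 'm) vec, 'i) vec)"

text \<open>At the pair \<open>(x, t)\<close> the correspondence \<open>V\<close> returns the maximisers of \<open>t\<close> over
  the truncated constraint set, together with the unit normals at \<open>x\<close> separating it from the
  preferred sets.  Only competitors \<open>w\<close> of norm strictly below \<open>rho\<close> are tested: the open
  ball, unlike the closed one, makes the graph closed by lower semicontinuity of \<open>K\<close> alone.\<close>

lemma truncated_quasi_variational_inequality:
  fixes J :: "'i::finite \<Rightarrow> 'm::finite set"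
    and X :: "'i \<Rightarrow> (real^'m) set"
    and K P :: "'i \<Rightarrow> (real^'m)^'i \<Rightarrow> (real^'m) set"
    and rho :: real
  assumes X_sub: "\<And>i. X i \<subseteq> coord_space (J i)"
    and K_map: "\<And>i. K i \<in> prod_set X \<rightarrow> Pow (X i)"
    and P_map: "\<And>i. P i \<in> prod_set X \<rightarrow> Pow (X i)"
    and X_ne: "prod_set X \<noteq> {}"
    and X_set: "\<And>i. closed (X i)" "\<And>i. convex (X i)"
    and graph_closed: "\<And>i. closed {(x, y). x \<in> prod_set X \<and> y \<in> K i x}"
    and K_lsc: "\<And>i. lsc_multimap (prod_set X) (X i) (K i)"
    and K_convex: "\<And>i x. x \<in> prod_set X \<Longrightarrow> convex (K i x)"
    and P_lsc: "\<And>i. lsc_multimap (prod_set X) (X i) (P i)"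
    and P_open: "\<And>i x. x \<in> prod_set X \<Longrightarrow> openin (top_of_set (coord_space (J i))) (P i x)"
    and P_irrefl: "\<And>i x. x \<in> prod_set X \<Longrightarrow> x $ i \<notin> convex hull (P i x)"
    and meets: "\<And>x. x \<in> prod_set X \<Longrightarrow>
      prod_set X \<inter> cball 0 rho \<inter> prod_set (\<lambda>i. K i x) \<noteq> {}"
  shows "\<exists>x\<in>prod_set X \<inter> cball 0 rho. \<exists>t. (\<forall>i. x $ i \<in> K i x) \<and>
    (\<forall>w\<in>prod_set (\<lambda>i. K i x). norm w < rho \<longrightarrow> t \<bullet> w \<le> t \<bullet> x) \<and>
    (\<forall>i. \<forall>z\<in>P i x. 0 < t $ i \<bullet> (z - x $ i))"
proof -
  define A where "A = prod_set X \<inter> cball 0 rho"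
  \<comment> \<open>Full unit balls replace spheres because the fixed point theorem needs a convex
    domain. That \<open>t\<close> is nonetheless useful comes later from strict inequalities, not
    from its norm.\<close>
  define B where "B = prod_set (\<lambda>i. coord_space (J i) \<inter> cball 0 1)"
  define V where "V = (\<lambda>(x, t). {(y, s). (\<forall>i. y $ i \<in> K i x) \<and>
    (\<forall>w\<in>prod_set (\<lambda>i. K i x). norm w < rho \<longrightarrow> t \<bullet> w \<le> t \<bullet> y) \<and>
    (\<forall>i. (P i x = {} \<or> norm (s $ i) = 1) \<and> (\<forall>z\<in>P i x. 0 \<le> s $ i \<bullet> (z - x $ i)))})"
  define G where "G = {(p, q). p \<in> A \<times> B \<and> q \<in> A \<times> B \<and> q \<in> V p}"
  have X_closed: "closed (prod_set X)"
    using X_set by (intro closed_prod_set) simp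
  have AB: "compact (A \<times> B)" "convex (A \<times> B)" "A \<times> B \<noteq> {}"
  proof -
    have "compact A"
      unfolding A_def using X_closed by (simp add: closed_Int_compact)
    moreover have "compact B"
      unfolding B_def
      by (intro compact_prod_set closed_Int_compact closed_subspace subspace_coord_space) simp
    ultimately show "compact (A \<times> B)"
      by (rule compact_Times)
    show "convex (A \<times> B)"
      unfolding A_def B_def using X_set
      by (intro convex_Times convex_Int convex_prod_set convex_cball
          subspace_imp_convex[OF subspace_coord_space])
    have "A \<noteq> {}"
      using X_ne meets unfolding A_def by blast
    moreover have "0 \<in> B"
      by (simp add: B_def prod_set_def coord_space_def)
    ultimately show "A \<times> B \<noteq> {}"
      by blast
  qed
  have "closed G"
  proof -
    have cont: "continuous_on UNIV (\<lambda>p :: ('m, 'i) graph_point. fst (fst p))"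
      by (intro continuous_intros)
    \<comment> \<open>The graph is cut out by closed conditions on \<open>((x, t), (y, s))\<close>:
      maximality (\<open>C1\<close>), the separating inequalities (\<open>C2\<close>), emptiness of
      \<open>P i x\<close> or norm one (\<open>C3\<close>, \<open>C4\<close>), and feasibility of
      \<open>y\<close> (\<open>C5\<close>).\<close>
    define C1 where "C1 = {p :: ('m, 'i) graph_point. fst (fst p) \<in> prod_set X \<and>
        (\<forall>w\<in>prod_set (\<lambda>i. K i (fst (fst p))).
          (p, w) \<in> {u. norm (snd u) < rho \<longrightarrow>
            snd (fst (fst u)) \<bullet> snd u \<le> snd (fst (fst u)) \<bullet> fst (snd (fst u))})}"
    define C2 where "C2 = (\<lambda>i. {p :: ('m, 'i) graph_point. fst (fst p) \<in> prod_set X \<and>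
        (\<forall>z\<in>P i (fst (fst p)).
          (p, z) \<in> {u. 0 \<le> snd (snd (fst u)) $ i \<bullet> (snd u - fst (fst (fst u)) $ i)})})"
    \<comment> \<open>Quantifying over \<open>P i\<close> with an impossible condition expresses
      emptiness, so the general closedness lemma applies with the empty set as
      \<open>C\<close>.\<close>
    define C3 where "C3 = (\<lambda>i. {p :: ('m, 'i) graph_point. fst (fst p) \<in> prod_set X \<and>
        (\<forall>z\<in>P i (fst (fst p)). (p, z) \<in> {})})"
    define C4 where "C4 = (\<lambda>i. {p :: ('m, 'i) graph_point. norm (snd (snd p) $ i) = 1})"
    define C5 where "C5 = (\<lambda>i. (\<lambda>p :: ('m, 'i) graph_point. (fst (fst p), fst (snd p) $ i)) -`
        {(x, y). x \<in> prod_set X \<and> y \<in> K i x})"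
    have l1: "lsc_multimap (prod_set X) (prod_set X) (\<lambda>x. prod_set (\<lambda>i. K i x))"
      using K_lsc K_map by (rule lsc_multimap_prod_set)
    have l2: "(\<lambda>x. prod_set (\<lambda>i. K i x)) \<in> prod_set X \<rightarrow> Pow (prod_set X)"
      using K_map unfolding prod_set_def by blast
    \<comment> \<open>The tested implication is closed in all variables because its premise
      \<open>norm w < rho\<close> is open and its conclusion is a weak inequality.\<close>
    have "closed C1"
      unfolding C1_def
      by (rule closed_all_lsc_multimap[OF l1 l2 cont X_closed])
        (intro closed_Collect_imp open_Collect_less closed_Collect_le continuous_intros)
    moreover have "closed (C2 i)" for i
      unfolding C2_def
      by (rule closed_all_lsc_multimap[OF P_lsc P_map cont X_closed])
        (intro closed_Collect_le continuous_intros)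
    moreover have "closed (C3 i)" for i
      unfolding C3_def
      by (rule closed_all_lsc_multimap[OF P_lsc P_map cont X_closed]) simp
    moreover have "closed (C4 i)" for i
      unfolding C4_def by (intro closed_Collect_eq continuous_intros)
    moreover have "closed (C5 i)" for i
      unfolding C5_def by (intro closed_vimage graph_closed continuous_intros)
    moreover have "closed ((A \<times> B) \<times> (A \<times> B))"
      using AB(1) by (intro closed_Times[of "_ \<times> _"] compact_imp_closed)
    moreover have "G = (A \<times> B) \<times> (A \<times> B) \<inter> C1 \<inter> (\<Inter>i. C2 i \<inter> (C3 i \<union> C4 i) \<inter> C5 i)"
    proof (rule set_eqI)
      fix p :: "('m, 'i) graph_point"
      obtain x t y s where "p = ((x, t), (y, s))"
        by (metis surj_pair)
      then show "p \<in> G \<longleftrightarrow>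
          p \<in> (A \<times> B) \<times> (A \<times> B) \<inter> C1 \<inter> (\<Inter>i. C2 i \<inter> (C3 i \<union> C4 i) \<inter> C5 i)"
        unfolding G_def V_def A_def C1_def C2_def C3_def C4_def C5_def by auto
    qed
    ultimately show ?thesis
      by (simp add: closed_Int closed_Un closed_INT)
  qed
  moreover have "\<exists>q. (p, q) \<in> G" if p: "p \<in> A \<times> B" for p
  proof -
    obtain x t where p_eq: "p = (x, t)" and xA: "x \<in> A" and x: "x \<in> prod_set X"
      using p by (auto simp: A_def)
    have "closed (prod_set (\<lambda>i. K i x))"
    proof (rule closed_prod_set)
      fix i
      have "K i x = (\<lambda>y. (x, y)) -` {(x, y). x \<in> prod_set X \<and> y \<in> K i x}"
        using x by auto
      then show "closed (K i x)"
        using closed_vimage[OF graph_closed[of i], of "Pair x"]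
        by (simp add: continuous_intros)
    qed
    then have "compact (A \<inter> prod_set (\<lambda>i. K i x))"
      unfolding A_def using X_closed
      by (metis closed_Int_compact compact_Int_closed compact_cball)
    moreover have "A \<inter> prod_set (\<lambda>i. K i x) \<noteq> {}"
      unfolding A_def using meets[OF x] .
    moreover have "continuous_on (A \<inter> prod_set (\<lambda>i. K i x)) (\<lambda>y. t \<bullet> y)"
      by (intro continuous_intros)
    ultimately obtain y where y: "y \<in> A" "y \<in> prod_set (\<lambda>i. K i x)"
        "\<And>w. w \<in> A \<inter> prod_set (\<lambda>i. K i x) \<Longrightarrow> t \<bullet> w \<le> t \<bullet> y"
      using continuous_attains_sup by (metis IntE)
    have max: "t \<bullet> w \<le> t \<bullet> y" if "w \<in> prod_set (\<lambda>i. K i x)" "norm w < rho" for w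
      using that K_map x by (intro y(3)) (auto simp: A_def prod_set_def)
    have "\<exists>s. s \<in> coord_space (J i) \<and> norm s \<le> 1 \<and> (P i x = {} \<or> norm s = 1) \<and>
        (\<forall>z\<in>P i x. 0 \<le> s \<bullet> (z - x $ i))" for i
    proof (cases "P i x = {}")
      case True
      then show ?thesis
        using subspace_0[OF subspace_coord_space] by (intro exI[of _ 0]) auto
    next
      case False
      have "x $ i \<in> X i" "P i x \<subseteq> X i"
        using P_map x by (auto simp: prod_set_def)
      then have "P i x \<subseteq> coord_space (J i)" "x $ i \<in> coord_space (J i)"
        using X_sub[of i] by auto
      from separating_unit_vector[OF this(1) False this(2) P_irrefl[OF x]]
      show ?thesis
        by auto
    qed
    then obtain s where "\<And>i. s i \<in> coord_space (J i) \<and> norm (s i) \<le> 1 \<and>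
        (P i x = {} \<or> norm (s i) = 1) \<and> (\<forall>z\<in>P i x. 0 \<le> s i \<bullet> (z - x $ i))"
      by metis
    then have "(p, (y, vec_lambda s)) \<in> G"
      using p p_eq y(1,2) max by (auto simp: G_def V_def B_def prod_set_def)
    then show ?thesis
      by blast
  qed
  moreover have "G \<subseteq> (A \<times> B) \<times> (A \<times> B)"
    by (auto simp: G_def)
  ultimately obtain x t where xt: "(x, t) \<in> A \<times> B"
      "(x, t) \<in> convex hull {q. ((x, t), q) \<in> G}"
    using kakutani_convex_hull[OF AB] by (metis surj_pair)
  then have x: "x \<in> prod_set X" "norm x \<le> rho"
    by (auto simp: A_def)
  \<comment> \<open>The norm-one condition is not convex, but the strict inequalities it yields are.
    With \<open>x\<close> and \<open>t\<close> fixed, \<open>H\<close> is a convex set containing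
    all values at \<open>(x, t)\<close>, hence also the hull point \<open>(x, t)\<close>
    itself.\<close>
  define H where "H = (prod_set (\<lambda>i. K i x) \<inter>
      (\<Inter>w\<in>{w \<in> prod_set (\<lambda>i. K i x). norm w < rho}. {y. t \<bullet> w \<le> t \<bullet> y})) \<times>
      prod_set (\<lambda>i. \<Inter>z\<in>P i x. {s. 0 < (z - x $ i) \<bullet> s})"
  have "{q. ((x, t), q) \<in> G} \<subseteq> H"
  proof clarify
    fix y s
    assume G: "((x, t), (y, s)) \<in> G"
    have "0 < (z - x $ i) \<bullet> s $ i" if z: "z \<in> P i x" for i z
    proof -
      have "s $ i \<in> coord_space (J i)" "s $ i \<noteq> 0" "\<And>z. z \<in> P i x \<Longrightarrow> 0 \<le> s $ i \<bullet> (z - x $ i)"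
        using G z by (auto simp: G_def V_def B_def prod_set_def)
      from supporting_vector_strict[OF P_open[OF x(1)] z this] show ?thesis
        by (simp add: inner_commute)
    qed
    then show "(y, s) \<in> H"
      using G by (auto simp: G_def V_def H_def prod_set_def)
  qed
  moreover have "convex H"
    unfolding H_def
    by (intro convex_Times convex_Int convex_prod_set convex_INT convex_halfspace_gt
        convex_halfspace_ge K_convex x(1))
  ultimately have "(x, t) \<in> H"
    using xt(2) hull_minimal by blast
  then show ?thesis
    using x by (intro bexI[of _ x] exI[of _ t]) (auto simp: H_def prod_set_def inner_commute)
qed

section \<open>From the truncated problem to an equilibrium\<close>

theorem theorem3p4:
  fixes J :: "'i::finite \<Rightarrow> 'm::finite set"
    and X :: "'i \<Rightarrow> (real^'m) set"
    and K P :: "'i \<Rightarrow> (real^'m)^'i \<Rightarrow> (real^'m) set"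
    and r :: "(real^'m)^'i \<Rightarrow> real"
    and rho :: real
  assumes X_sub: "\<And>i. X i \<subseteq> coord_space (J i)"
    and K_map: "\<And>i. K i \<in> prod_set X \<rightarrow> Pow (X i)"
    and P_map: "\<And>i. P i \<in> prod_set X \<rightarrow> Pow (X i)"
    and X_set: "\<And>i. X i \<noteq> {} \<and> closed (X i) \<and> convex (X i)"
    and K_closed: "\<And>i. closed_multimap (prod_set X) (X i) (K i)"
    and K_lsc: "\<And>i. lsc_multimap (prod_set X) (X i) (K i)"
    and K_values: "\<And>i x. x \<in> prod_set X \<Longrightarrow> K i x \<noteq> {} \<and> convex (K i x)"
    and P_lsc: "\<And>i. lsc_multimap (prod_set X) (X i) (P i)"
    and P_open: "\<And>i x. x \<in> prod_set X \<Longrightarrow>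
                   openin (top_of_set (coord_space (J i))) (P i x)"
    and P_irrefl: "\<And>i x. x \<in> prod_set X \<Longrightarrow> x $ i \<notin> convex hull (P i x)"
    and r_pos: "\<And>x. x \<in> prod_set X \<Longrightarrow> r x > 0"
    and coercive: "\<And>x. x \<in> prod_set X \<Longrightarrow> coercive_at K P x (r x)"
    and r_bdd: "bdd_above (r ` prod_set X)"
    and rho: "rho > (SUP x\<in>prod_set X. r x)"
    and K_meets_ball: "\<And>x. x \<in> prod_set X \<Longrightarrow>
                         prod_set (\<lambda>i. K i x) \<inter> cball 0 rho \<noteq> {}"
  shows "\<exists>x. equilibrium X K P x"
proof -
  have K_sub: "prod_set (\<lambda>i. K i x) \<subseteq> prod_set X" if "x \<in> prod_set X" for x
    using K_map that unfolding prod_set_def by blast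
  have X_ne: "prod_set X \<noteq> {}"
  proof -
    have "(\<chi> i. SOME a. a \<in> X i) \<in> prod_set X"
      using X_set by (simp add: prod_set_def some_in_eq)
    then show ?thesis
      by blast
  qed
  have X_closed_convex: "closed (X i)" "convex (X i)" for i
    using X_set by auto
  have K_convex: "convex (K i x)" if "x \<in> prod_set X" for i x
    using K_values that by blast
  have X_closed: "closed (prod_set X)"
    using X_set by (intro closed_prod_set) simp
  have graph_closed: "closed {(x, y). x \<in> prod_set X \<and> y \<in> K i x}" for i
    using K_closed[of i] X_closed X_set[of i] unfolding closed_multimap_def
    by (blast intro: closedin_closed_trans closed_Times)
  have meets: "prod_set X \<inter> cball 0 rho \<inter> prod_set (\<lambda>i. K i x) \<noteq> {}"
    if "x \<in> prod_set X" for x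
    using K_meets_ball[OF that] K_sub[OF that] by blast
  have "\<exists>x\<in>prod_set X \<inter> cball 0 rho. \<exists>t. (\<forall>i. x $ i \<in> K i x) \<and>
      (\<forall>w\<in>prod_set (\<lambda>i. K i x). norm w < rho \<longrightarrow> t \<bullet> w \<le> t \<bullet> x) \<and>
      (\<forall>i. \<forall>z\<in>P i x. 0 < t $ i \<bullet> (z - x $ i))"
    by (rule truncated_quasi_variational_inequality[OF X_sub K_map P_map X_ne X_closed_convex
        graph_closed K_lsc K_convex P_lsc P_open P_irrefl meets])
  then obtain x t where xt: "x \<in> prod_set X \<inter> cball 0 rho" "\<forall>i. x $ i \<in> K i x"
      "\<forall>w\<in>prod_set (\<lambda>i. K i x). norm w < rho \<longrightarrow> t \<bullet> w \<le> t \<bullet> x"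
      "\<forall>i. \<forall>z\<in>P i x. 0 < t $ i \<bullet> (z - x $ i)"
    by (elim bexE exE conjE)
  then have x: "x \<in> prod_set X" "norm x \<le> rho" "\<And>i. x $ i \<in> K i x"
    and max: "\<And>w. w \<in> prod_set (\<lambda>i. K i x) \<Longrightarrow> norm w < rho \<Longrightarrow> t \<bullet> w \<le> t \<bullet> x"
    and pos: "\<And>i z. z \<in> P i x \<Longrightarrow> 0 < t $ i \<bullet> (z - x $ i)"
    by auto
  have "norm x < rho"
  proof (rule ccontr)
    assume *: "\<not> norm x < rho"
    \<comment> \<open>On the sphere of radius \<open>rho\<close>, the point \<open>x\<close> lies
      outside the ball of radius \<open>r x\<close>, so coercivity at \<open>x\<close> may be
      applied with \<open>y\<close> equal to \<open>x\<close>.\<close>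
    have "r x < rho"
      using cSUP_upper[OF x(1) r_bdd] rho by linarith
    then have "x \<in> prod_set (\<lambda>i. K i x) - cball 0 (r x)"
      using * x(3) by (simp add: prod_set_def)
    then obtain z where z: "z \<in> prod_set (\<lambda>i. K i x)" "norm z < norm x" "\<And>i. z $ i \<in> P i x"
      using coercive[OF x(1)] unfolding coercive_at_def by blast
    \<comment> \<open>Every player gains strictly in the direction \<open>t $ i\<close>, so the sum
      gives \<open>t \<bullet> z > t \<bullet> x\<close>. As \<open>z\<close> is shorter than
      \<open>x\<close>, it is an admissible competitor in \<open>max\<close>.\<close>
    have "0 < (\<Sum>i\<in>UNIV. t $ i \<bullet> (z $ i - x $ i))"
      using pos[OF z(3)] by (intro sum_pos) auto
    also have "\<dots> = t \<bullet> z - t \<bullet> x"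
      unfolding inner_vec_def[of t] inner_diff_right by (rule sum_subtractf)
    finally show False
      using max[OF z(1)] z(2) x(2) by linarith
  qed
  have "P i x \<inter> K i x = {}" for i
  proof (rule ccontr)
    assume "P i x \<inter> K i x \<noteq> {}"
    then obtain z where z: "z \<in> P i x" "z \<in> K i x"
      by blast
    \<comment> \<open>A unilateral deviation: only coordinate \<open>i\<close> moves, towards
      \<open>z\<close>. A short step stays in the open ball because \<open>norm x < rho\<close>, and
      in \<open>K i x\<close> by convexity, so it may be compared with \<open>x\<close>.\<close>
    define d :: "(real^'m)^'i" where "d = axis i (z - x $ i)"
    have "((\<lambda>e. norm (x + e *\<^sub>R d)) \<longlongrightarrow> norm (x + 0 *\<^sub>R d)) (at_right 0)"
      by (intro tendsto_intros)
    then have "eventually (\<lambda>e. norm (x + e *\<^sub>R d) < rho) (at_right 0)"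
      using \<open>norm x < rho\<close> by (intro order_tendstoD) auto
    moreover have "eventually (\<lambda>e::real. e \<in> {0<..<1}) (at_right 0)"
      by (intro eventually_at_right_real) simp
    ultimately obtain e :: real where e: "norm (x + e *\<^sub>R d) < rho" "0 < e" "e < 1"
      using eventually_happens[OF eventually_conj] by force
    have "(x + e *\<^sub>R d) $ j \<in> K j x" for j
    proof (cases "j = i")
      case True
      have "(1 - e) *\<^sub>R x $ i + e *\<^sub>R z \<in> K i x"
        using K_values[OF x(1), of i] x(3)[of i] z(2) e by (intro convexD) auto
      then show ?thesis
        using True by (simp add: d_def algebra_simps)
    qed (use x(3) in \<open>simp add: d_def axis_def\<close>)
    then have "t \<bullet> (x + e *\<^sub>R d) \<le> t \<bullet> x"
      using e(1) by (intro max) (auto simp: prod_set_def)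
    then have "e * (t $ i \<bullet> (z - x $ i)) \<le> 0"
      by (simp add: inner_add_right d_def inner_axis)
    then show False
      using pos[OF z(1)] e(2) by (simp add: mult_le_0_iff)
  qed
  then show ?thesis
    unfolding equilibrium_def using x by blast
qed

end
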